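(* Suppose Assumption A (defined in the context) holds and $\Delta^k\le\Delta_{\max}$. If the interpolation set $\{z^0:=\theta^k,z^1,\ldots,z^d\}$ is $\Lambda$-poised in $B(\theta^k,\Delta^k)$ and for each $t=0,\ldots,d$ and each $i=1,\ldots,n$ we have $\|\tilde x_i(z^t)-\hat x_i(z^t)\|\le c(\Delta^k)^2$ for some $c>0$, then the corresponding models $M^k$ and $m^k$ are fully linear models for $r$ and $f$ respectively in $B(\theta^k,\Delta^k)$.
   Context: Let $n,d\ge1$, data $x_1,\ldots,x_n$, and maps $\theta\mapsto\hat x_i(\theta)$; set $r_i(\theta)=\|\hat x_i(\theta)-x_i\|$, $r=(r_1,\ldots,r_n):\mathbb{R}^d\to\mathbb{R}^n$, $f(\theta)=\frac1n\|r(\theta)\|^2$. Approximations $\tilde x_i(\theta)$ of $\hat x_i(\theta)$ give $\tilde r_i(\theta)=\|\tilde x_i(\theta)-x_i\|$, $\tilde f(\theta)=\frac1n\|\tilde r(\theta)\|^2$. Given $\theta^k$, $\Delta^k>0$ and points $z^0=\theta^k,z^1,\ldots,z^d$ with $z^t-\theta^k$ ($t\ge1$) linearly independent, let $J^k\in\mathbb{R}^{n\times d}$ be the unique matrix with $\tilde r(\theta^k)+J^k(z^t-\theta^k)=\tilde r(z^t)$, $t=1,\ldots,d$; $M^k(s)=\tilde r(\theta^k)+J^ks$, $m^k(s)=\frac1n\|M^k(s)\|^2$. The Lagrange polynomials of the set are the affine functions $\ell_t$, $t=0,\ldots,d$, with $\ell_t(z^s)=\delta_{s,t}$; the set is $\Lambda$-poised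 in $B(\theta^k,\Delta^k)$ ($\Lambda>0$) if $|\ell_t(\theta^k+s)|\le\Lambda$ for all $t$ and all $\|s\|\le\Delta^k$. $m^k$ is fully linear for $f$ in $B(\theta^k,\Delta^k)$ if there exist constants $\kappa_{\rm ef},\kappa_{\rm eg}>0$ independent of $\theta^k$ and $\Delta^k$ with $|f(\theta^k+s)-m^k(s)|\le\kappa_{\rm ef}(\Delta^k)^2$ and $\|\nabla f(\theta^k+s)-\nabla m^k(s)\|\le\kappa_{\rm eg}\Delta^k$ for all $\|s\|\le\Delta^k$; analogously $M^k$ is fully linear for $r$ if $\|r(\theta^k+s)-M^k(s)\|\le\kappa_{\rm ef}'(\Delta^k)^2$ and $\|\partial r(\theta^k+s)^T-J^k\|\le\kappa_{\rm eg}'\Delta^k$ for all $\|s\|\le\Delta^k$, with constants independent of $\theta^k,\Delta^k$. Assumption A: for given $\theta^0$ and $\Delta_{\max}>0$, the set $\mathcal{B}=\{z:\|z-\theta\|\le\Delta_{\max}\text{ for some }\theta\text{ with }f(\theta)\le f(\theta^0)\}$ is bounded and $r$ is continuously differentiable with $\partial r$ Lipschitz continuous (constant $L_J$) on $\mathcal{B}$; here $\theta^k$ is assumed to satisfy $f(\theta^k)\le f(\theta^0)$ (it is an iterate of a monotone method). *)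

theory Defs
  imports "HOL-Analysis.Analysis"
begin

text \<open>Residual vector r(theta) = (||xhat_i(theta) - x_i||)_i, indexed by a finite type 'n (n = CARD('n)).\<close>
definition resid :: "('n::finite \<Rightarrow> 'a \<Rightarrow> 'b::real_normed_vector) \<Rightarrow> ('n \<Rightarrow> 'b) \<Rightarrow> 'a \<Rightarrow> real^'n" where
  "resid xh x \<theta> = (\<chi> i. norm (xh i \<theta> - x i))"

text \<open>Objective f(theta) = (1/n) ||r(theta)||^2.\<close>
definition obj :: "('n::finite \<Rightarrow> 'a \<Rightarrow> 'b::real_normed_vector) \<Rightarrow> ('n \<Rightarrow> 'b) \<Rightarrow> 'a \<Rightarrow> real" where
  "obj xh x \<theta> = (1 / real CARD('n)) * (norm (resid xh x \<theta>))\<^sup>2"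

text \<open>The set B = { z : ||z - theta|| <= Delta_max for some theta with f(theta) <= f(theta0) }.\<close>
definition setB :: "('n::finite \<Rightarrow> real^'d \<Rightarrow> 'b::real_normed_vector) \<Rightarrow> ('n \<Rightarrow> 'b) \<Rightarrow> real^'d \<Rightarrow> real \<Rightarrow> (real^'d) set" where
  "setB xh x \<theta>0 Dmax = {z. \<exists>\<theta>. obj xh x \<theta> \<le> obj xh x \<theta>0 \<and> norm (z - \<theta>) \<le> Dmax}"

text \<open>Assumption A, with Dr the Jacobian (n x d matrix) of r.\<close>
definition assumptionA :: "('n::finite \<Rightarrow> real^'d \<Rightarrow> 'b::real_normed_vector) \<Rightarrow> ('n \<Rightarrow> 'b) \<Rightarrow> real^'d \<Rightarrow> real
    \<Rightarrow> (real^'d \<Rightarrow> real^'d^'n) \<Rightarrow> bool" where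
  "assumptionA xh x \<theta>0 Dmax Dr \<longleftrightarrow>
     bounded (setB xh x \<theta>0 Dmax) \<and>
     (\<forall>\<theta>\<in>setB xh x \<theta>0 Dmax. (resid xh x has_derivative (\<lambda>h. Dr \<theta> *v h)) (at \<theta>)) \<and>
     continuous_on (setB xh x \<theta>0 Dmax) Dr \<and>
     (\<exists>LJ. \<forall>a\<in>setB xh x \<theta>0 Dmax. \<forall>b\<in>setB xh x \<theta>0 Dmax. norm (Dr a - Dr b) \<le> LJ * norm (a - b))"

text \<open>J^k: the unique matrix with rtil(theta) + J (z^t - theta) = rtil(z^t), t = 1..d.\<close>
definition interpJ :: "(real^'d \<Rightarrow> real^'n) \<Rightarrow> real^'d \<Rightarrow> (nat \<Rightarrow> real^'d) \<Rightarrow> real^'d^'n" where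
  "interpJ rt \<theta> z = (THE J. \<forall>t\<in>{1..CARD('d)}. rt \<theta> + J *v (z t - \<theta>) = rt (z t))"

text \<open>Interpolation set {z^0,...,z^d}: z^0 = theta, z^t - theta (t=1..d) linearly independent.\<close>
definition interp_set :: "real^'d \<Rightarrow> (nat \<Rightarrow> real^'d) \<Rightarrow> bool" where
  "interp_set \<theta> z \<longleftrightarrow> z 0 = \<theta> \<and> inj_on (\<lambda>t. z t - \<theta>) {1..CARD('d)} \<and>
     independent ((\<lambda>t. z t - \<theta>) ` {1..CARD('d)})"

text \<open>Lagrange polynomials: affine functions l_t (t = 0..d) with l_t(z^s) = delta_{s,t}.\<close>
definition lagrange_polys :: "(nat \<Rightarrow> real^'d) \<Rightarrow> (nat \<Rightarrow> real^'d \<Rightarrow> real) \<Rightarrow> bool" where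
  "lagrange_polys z l \<longleftrightarrow> (\<forall>t\<le>CARD('d).
     (\<exists>a b. l t = (\<lambda>y. a \<bullet> y + b)) \<and> (\<forall>s\<le>CARD('d). l t (z s) = (if s = t then 1 else 0)))"

definition poised :: "real \<Rightarrow> real^'d \<Rightarrow> real \<Rightarrow> (nat \<Rightarrow> real^'d) \<Rightarrow> bool" where
  "poised \<Lambda> \<theta> \<Delta> z \<longleftrightarrow> (\<forall>l. lagrange_polys z l \<longrightarrow>
     (\<forall>t\<le>CARD('d). \<forall>s. norm s \<le> \<Delta> \<longrightarrow> \<bar>l t (\<theta> + s)\<bar> \<le> \<Lambda>))"

end

(* Along each direction z^t - theta the interpolation matrix J reproduces the differences of
   the approximate residual, which differ from those of r by O(Delta^2) (approximation error at
   the nodes) and from Dr(theta) (z^t - theta) by O(Delta^2) (Taylor, Dr Lipschitz).  So the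
   error matrix J - Dr(theta) is O(Delta^2) on the basis z^t - theta; since the coordinates of any
   ||s|| <= Delta in this basis are values of Lagrange polynomials, poisedness bounds them by
   Lambda and J - Dr(theta) is O(Delta) as a matrix.  This gives full linearity of M; that of
   m = ||M||^2 / n follows from the product rule, as Assumption A bounds r and Dr uniformly on
   the bounded set B. *)

theory Submission
  imports Defs
begin

section \<open>Interpolation sets and their Lagrange polynomials\<close>

definition interp_dirs :: "real^'d \<Rightarrow> (nat \<Rightarrow> real^'d) \<Rightarrow> (real^'d) set" where
  "interp_dirs \<theta> z = (\<lambda>t. z t - \<theta>) ` {1..CARD('d)}"

text \<open>For \<open>t \<ge> 1\<close>, \<open>interp_coord \<theta> z t (y - \<theta>)\<close> is the Lagrange polynomial \<open>\<ell>\<^sub>t(y)\<close>.\<close>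

definition interp_coord :: "real^'d \<Rightarrow> (nat \<Rightarrow> real^'d) \<Rightarrow> nat \<Rightarrow> real^'d \<Rightarrow> real" where
  "interp_coord \<theta> z t v = representation (interp_dirs \<theta> z) v (z t - \<theta>)"

lemma interp_set_basis:
  fixes \<theta> :: "real^'d"
  assumes "interp_set \<theta> z"
  shows "independent (interp_dirs \<theta> z)" and "span (interp_dirs \<theta> z) = UNIV"
proof -
  show ind: "independent (interp_dirs \<theta> z)"
    using assms by (simp add: interp_set_def interp_dirs_def)
  have "inj_on (\<lambda>t. z t - \<theta>) {1..CARD('d)}"
    using assms by (simp add: interp_set_def)
  then have "card (interp_dirs \<theta> z) = CARD('d)"
    by (simp add: interp_dirs_def card_image)
  then have "UNIV \<subseteq> span (interp_dirs \<theta> z)"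
    by (intro card_ge_dim_independent[OF _ ind]) auto
  then show "span (interp_dirs \<theta> z) = UNIV" by auto
qed

lemma linear_interp_coord:
  fixes \<theta> :: "real^'d"
  shows "interp_set \<theta> z \<Longrightarrow> linear (interp_coord \<theta> z t)"
  using real_vector.linear_representation[OF interp_set_basis]
  unfolding interp_coord_def[abs_def] real_scaleR_def[abs_def, symmetric]
  by (simp add: linear_def)

lemma interp_coord_node:
  fixes \<theta> :: "real^'d"
  assumes "interp_set \<theta> z" "s \<in> {1..CARD('d)}" "t \<in> {1..CARD('d)}"
  shows "interp_coord \<theta> z t (z s - \<theta>) = (if s = t then 1 else 0)"
proof -
  have "z s - \<theta> \<in> interp_dirs \<theta> z" using assms(2) by (simp add: interp_dirs_def)
  moreover have "z s - \<theta> = z t - \<theta> \<longleftrightarrow> s = t"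
    using assms inj_onD by (fastforce simp: interp_set_def)
  ultimately show ?thesis
    using assms(1) by (auto simp: interp_coord_def real_vector.representation_basis interp_set_basis)
qed

lemma interp_coord_expansion:
  fixes \<theta> :: "real^'d"
  assumes "interp_set \<theta> z"
  shows "v = (\<Sum>t\<in>{1..CARD('d)}. interp_coord \<theta> z t v *\<^sub>R (z t - \<theta>))"
proof -
  have inj: "inj_on (\<lambda>t. z t - \<theta>) {1..CARD('d)}" using assms by (simp add: interp_set_def)
  have "v = (\<Sum>b\<in>interp_dirs \<theta> z. representation (interp_dirs \<theta> z) v b *\<^sub>R b)"
    using interp_set_basis[OF assms]
    by (simp add: real_vector.sum_representation_eq interp_dirs_def)
  also have "\<dots> = (\<Sum>t\<in>{1..CARD('d)}. interp_coord \<theta> z t v *\<^sub>R (z t - \<theta>))"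
    unfolding interp_dirs_def interp_coord_def by (rule sum.reindex[OF inj, unfolded o_def])
  finally show ?thesis .
qed

lemma linear_eq_inner_adjoint:
  fixes g :: "real^'d \<Rightarrow> real"
  assumes "linear g"
  shows "g y = adjoint g 1 \<bullet> y"
  using adjoint_works[OF assms, of y 1] by (simp add: inner_commute)

definition interp_lagrange :: "real^'d \<Rightarrow> (nat \<Rightarrow> real^'d) \<Rightarrow> nat \<Rightarrow> real^'d \<Rightarrow> real" where
  "interp_lagrange \<theta> z t y =
     (if t = 0 then 1 - (\<Sum>u\<in>{1..CARD('d)}. interp_coord \<theta> z u (y - \<theta>))
      else interp_coord \<theta> z t (y - \<theta>))"

lemma interp_lagrange_affine:
  fixes \<theta> :: "real^'d"
  assumes "interp_set \<theta> z"
  shows "\<exists>a b. interp_lagrange \<theta> z t = (\<lambda>y. a \<bullet> y + b)"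
proof -
  define a where "a u = adjoint (interp_coord \<theta> z u) 1" for u
  have coord: "interp_coord \<theta> z u (y - \<theta>) = a u \<bullet> y - a u \<bullet> \<theta>" for u y
    using linear_eq_inner_adjoint[OF linear_interp_coord[OF assms]]
    by (simp add: a_def inner_diff_right)
  show ?thesis
  proof (cases "t = 0")
    case True
    show ?thesis
      by (intro exI[of _ "- (\<Sum>u\<in>{1..CARD('d)}. a u)"]
          exI[of _ "1 + (\<Sum>u\<in>{1..CARD('d)}. a u \<bullet> \<theta>)"])
        (auto simp: interp_lagrange_def True coord sum_subtractf inner_sum_left)
  next
    case False
    show ?thesis
      by (intro exI[of _ "a t"] exI[of _ "- (a t \<bullet> \<theta>)"])
        (auto simp: interp_lagrange_def False coord)
  qed
qed

lemma interp_lagrange_node: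
  fixes \<theta> :: "real^'d"
  assumes "interp_set \<theta> z" "s \<le> CARD('d)" "t \<le> CARD('d)"
  shows "interp_lagrange \<theta> z t (z s) = (if s = t then 1 else 0)"
proof (cases "s = 0")
  case True
  then have "z s = \<theta>" using assms(1) by (simp add: interp_set_def)
  then show ?thesis
    using True linear_0[OF linear_interp_coord[OF assms(1)]] by (simp add: interp_lagrange_def)
next
  case False
  then have s: "s \<in> {1..CARD('d)}" using assms(2) by simp
  have "(\<Sum>u\<in>{1..CARD('d)}. interp_coord \<theta> z u (z s - \<theta>)) = 1"
    using s by (simp add: interp_coord_node[OF assms(1) s] sum.delta)
  then show ?thesis
    using False assms(3) s by (auto simp: interp_lagrange_def interp_coord_node[OF assms(1)])
qed

lemma lagrange_polys_interp_lagrange: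
  fixes \<theta> :: "real^'d"
  shows "interp_set \<theta> z \<Longrightarrow> lagrange_polys z (interp_lagrange \<theta> z)"
  by (simp add: lagrange_polys_def interp_lagrange_affine interp_lagrange_node)

lemma poised_interp_coord_bound:
  fixes \<theta> :: "real^'d"
  assumes "interp_set \<theta> z" "poised \<Lambda> \<theta> \<Delta> z" "t \<in> {1..CARD('d)}" "norm s \<le> \<Delta>"
  shows "\<bar>interp_coord \<theta> z t s\<bar> \<le> \<Lambda>"
  using assms lagrange_polys_interp_lagrange[OF assms(1)]
  by (force simp: poised_def interp_lagrange_def)

lemma interpJ_interpolates:
  fixes \<theta> :: "real^'d" and rt :: "real^'d \<Rightarrow> real^'n"
  assumes "interp_set \<theta> z" "t \<in> {1..CARD('d)}"
  shows "rt \<theta> + interpJ rt \<theta> z *v (z t - \<theta>) = rt (z t)"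
proof -
  let ?V = "interp_dirs \<theta> z"
  let ?P = "\<lambda>J. \<forall>t\<in>{1..CARD('d)}. rt \<theta> + J *v (z t - \<theta>) = rt (z t)"
  obtain h :: "real^'d \<Rightarrow> real^'n" where h: "linear h" "\<And>b. b \<in> ?V \<Longrightarrow> h b = rt (\<theta> + b) - rt \<theta>"
    using real_vector.linear_independent_extend[OF interp_set_basis(1)[OF assms(1)],
        of "\<lambda>b. rt (\<theta> + b) - rt \<theta>"] by blast
  have "?P (matrix h)"
  proof
    fix t assume "t \<in> {1..CARD('d)}"
    then have "h (z t - \<theta>) = rt (z t) - rt \<theta>"
      using h(2)[of "z t - \<theta>"] by (simp add: interp_dirs_def)
    then show "rt \<theta> + matrix h *v (z t - \<theta>) = rt (z t)"
      by (simp add: matrix_vector_mul(2)[OF h(1)])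
  qed
  moreover have "J = matrix h" if "?P J" for J
  proof -
    have "J *v b = matrix h *v b" if "b \<in> ?V" for b
    proof -
      obtain t where "t \<in> {1..CARD('d)}" "b = z t - \<theta>"
        using \<open>b \<in> ?V\<close> by (auto simp: interp_dirs_def)
      then have "rt \<theta> + J *v b = rt \<theta> + matrix h *v b"
        using \<open>?P J\<close> \<open>?P (matrix h)\<close> by simp
      then show ?thesis by simp
    qed
    then have "J *v v = matrix h *v v" for v
      using real_vector.linear_eq_on_span[OF matrix_vector_mul_linear matrix_vector_mul_linear]
        interp_set_basis(2)[OF assms(1)] by blast
    then show ?thesis by (rule matrix_eq[THEN iffD2, rule_format])
  qed
  ultimately have "?P (interpJ rt \<theta> z)"
    unfolding interpJ_def by (rule theI)
  then show ?thesis using assms(2) by blast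
qed

section \<open>Frobenius norm of matrices\<close>

text \<open>The norm on \<open>real^'n^'m\<close> is the Frobenius norm, not the operator norm.\<close>

lemma power2_norm_matrix: "(norm (A :: real^'n^'m))\<^sup>2 = (\<Sum>i\<in>UNIV. \<Sum>j\<in>UNIV. (A $ i $ j)\<^sup>2)"
  unfolding power2_norm_eq_inner by (simp add: inner_vec_def power2_eq_square)

lemma norm_transpose: "norm (transpose (A :: real^'n^'m)) = norm A"
proof -
  have "(norm (transpose A))\<^sup>2 = (norm A)\<^sup>2"
    by (simp add: power2_norm_matrix transpose_def sum.swap[of _ "UNIV :: 'm set"])
  then show ?thesis by (simp add: power2_eq_iff_nonneg)
qed

lemma norm_matrix_vector_mult_le: "norm ((A :: real^'n^'m) *v x) \<le> norm A * norm x"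
proof -
  have "(norm (A *v x))\<^sup>2 = (\<Sum>i\<in>UNIV. (A $ i \<bullet> x)\<^sup>2)"
    unfolding power2_norm_eq_inner by (simp add: inner_vec_def matrix_mult_dot power2_eq_square)
  also have "\<dots> \<le> (\<Sum>i\<in>UNIV. (A $ i \<bullet> A $ i) * (x \<bullet> x))"
    by (intro sum_mono Cauchy_Schwarz_ineq)
  also have "\<dots> = (norm A * norm x)\<^sup>2"
    by (simp add: power2_norm_eq_inner power_mult_distrib inner_vec_def sum_distrib_right)
  finally show ?thesis
    by (rule power2_le_imp_le) simp
qed

lemma norm_vector_matrix_mult_le: "norm (x v* (A :: real^'n^'m)) \<le> norm x * norm A"
  using norm_matrix_vector_mult_le[of "transpose A" x] by (simp add: norm_transpose mult.commute)

lemma norm_matrix_le_of_bound: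
  fixes A :: "real^'n^'m"
  assumes "\<And>h. norm (A *v h) \<le> K * norm h"
  shows "norm A \<le> sqrt (real CARD('n)) * K"
proof -
  have "0 \<le> K * norm (axis undefined 1 :: real^'n)"
    by (rule order_trans[OF norm_ge_zero assms])
  then have K: "0 \<le> K" by simp
  have "(norm A)\<^sup>2 = (\<Sum>j\<in>UNIV. (norm (A *v axis j 1))\<^sup>2)"
    unfolding power2_norm_matrix power2_norm_eq_inner
    by (simp add: sum.swap[of _ "UNIV :: 'm set"] matrix_vector_mult_basis column_def
        inner_vec_def power2_eq_square)
  also have "\<dots> \<le> (\<Sum>j\<in>(UNIV :: 'n set). K\<^sup>2)"
    using assms[of "axis _ 1"] by (intro sum_mono power_mono) auto
  finally have "norm A \<le> sqrt (real CARD('n) * K\<^sup>2)"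
    by (intro real_le_rsqrt) simp
  then show ?thesis using K by (simp add: real_sqrt_mult)
qed

section \<open>Error estimates\<close>

lemma poised_matrix_bound:
  fixes \<theta> :: "real^'d" and E :: "real^'d^'n"
  assumes z: "interp_set \<theta> z" and P: "poised \<Lambda> \<theta> \<Delta> z" and "0 < \<Delta>"
    and nodes: "\<And>t. t \<in> {1..CARD('d)} \<Longrightarrow> norm (E *v (z t - \<theta>)) \<le> K * \<Delta>\<^sup>2"
  shows "norm (E *v h) \<le> real CARD('d) * \<Lambda> * K * \<Delta> * norm h"
proof -
  have small: "norm (E *v v) \<le> real CARD('d) * \<Lambda> * K * \<Delta>\<^sup>2" if "norm v \<le> \<Delta>" for v
  proof -
    have "E *v v = (\<Sum>t\<in>{1..CARD('d)}. interp_coord \<theta> z t v *\<^sub>R (E *v (z t - \<theta>)))"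
      by (subst interp_coord_expansion[OF z, of v])
        (simp add: linear_sum[OF matrix_vector_mul_linear] matrix_vector_mult_scaleR)
    also have "norm \<dots> \<le> (\<Sum>t\<in>{1..CARD('d)}. \<bar>interp_coord \<theta> z t v\<bar> * norm (E *v (z t - \<theta>)))"
      by (rule norm_sum[THEN order_trans]) simp
    also have "\<dots> \<le> (\<Sum>t\<in>{1..CARD('d)}. \<Lambda> * (K * \<Delta>\<^sup>2))"
      using poised_interp_coord_bound[OF z P _ that] nodes
      by (intro sum_mono mult_mono) (auto intro: order_trans[OF abs_ge_zero])
    finally show ?thesis by simp
  qed
  show ?thesis
  proof (cases "h = 0")
    case False
    let ?v = "(\<Delta> / norm h) *\<^sub>R h"
    have "norm (E *v h) = norm h / \<Delta> * norm (E *v ?v)"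
      using False \<open>0 < \<Delta>\<close> by (simp add: matrix_vector_mult_scaleR)
    also have "\<dots> \<le> norm h / \<Delta> * (real CARD('d) * \<Lambda> * K * \<Delta>\<^sup>2)"
      using False \<open>0 < \<Delta>\<close> by (intro mult_left_mono small) auto
    finally show ?thesis
      using \<open>0 < \<Delta>\<close> by (simp add: power2_eq_square mult_ac)
  qed simp
qed

lemma jacobian_lipschitz_remainder:
  fixes f :: "real^'d \<Rightarrow> real^'n" and Df :: "real^'d \<Rightarrow> real^'d^'n"
  assumes deriv: "\<And>y. y \<in> cball a \<rho> \<Longrightarrow> (f has_derivative (*v) (Df y)) (at y)"
    and lip: "\<And>y. y \<in> cball a \<rho> \<Longrightarrow> norm (Df y - Df a) \<le> L * norm (y - a)"
    and "norm v \<le> \<rho>" "0 \<le> L"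
  shows "norm (f (a + v) - f a - Df a *v v) \<le> L * (norm v)\<^sup>2"
proof -
  let ?C = "cball a (norm v)"
  let ?g = "\<lambda>y. f y - Df a *v y"
  have C: "y \<in> cball a \<rho>" if "y \<in> ?C" for y
    using that \<open>norm v \<le> \<rho>\<close> by auto
  have "(?g has_derivative (*v) (Df y - Df a)) (at y within ?C)" if "y \<in> ?C" for y
    using has_derivative_diff[OF deriv[OF C[OF that]]
        bounded_linear_imp_has_derivative[OF matrix_vector_mul_bounded_linear]]
    by (auto intro: has_derivative_at_withinI simp: matrix_vector_mult_diff_rdistrib[abs_def])
  moreover have "onorm ((*v) (Df y - Df a)) \<le> L * norm v" if "y \<in> ?C" for y
  proof (rule onorm_le)
    fix h
    have "norm (Df y - Df a) \<le> L * norm v"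
      using lip[OF C[OF that]] that \<open>0 \<le> L\<close>
      by (auto simp: dist_norm norm_minus_commute intro: order_trans mult_left_mono)
    then show "norm ((Df y - Df a) *v h) \<le> L * norm v * norm h"
      by (rule order_trans[OF norm_matrix_vector_mult_le mult_right_mono]) simp
  qed
  ultimately have "norm (?g (a + v) - ?g a) \<le> L * norm v * norm (a + v - a)"
    by (intro differentiable_bound[OF convex_cball]) (auto simp: dist_norm)
  then show ?thesis
    by (simp add: matrix_vector_right_distrib algebra_simps power2_eq_square)
qed

lemma gderiv_scaled_power2_norm:
  fixes r :: "real^'d \<Rightarrow> real^'n"
  assumes "(r has_derivative (*v) A) (at y)" and "GDERIV (\<lambda>y. k * (norm (r y))\<^sup>2) y :> g"
  shows "g = (2 * k) *\<^sub>R (r y v* A)"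
proof -
  have "((\<lambda>y. k * (r y \<bullet> r y)) has_derivative (\<lambda>h. k * (r y \<bullet> (A *v h) + (A *v h) \<bullet> r y))) (at y)"
    by (intro has_derivative_mult_right has_derivative_inner assms(1))
  moreover have "h \<bullet> (r y v* A) = r y \<bullet> (A *v h)" for h
    by (metis dot_lmul_matrix inner_commute)
  ultimately have "((\<lambda>y. k * (norm (r y))\<^sup>2) has_derivative (\<lambda>h. h \<bullet> ((2 * k) *\<^sub>R (r y v* A)))) (at y)"
    by (simp add: power2_norm_eq_inner inner_commute[of "A *v _"] algebra_simps)
  with assms(2) have "(\<lambda>h. h \<bullet> g) = (\<lambda>h. h \<bullet> ((2 * k) *\<^sub>R (r y v* A)))"
    unfolding gderiv_def by (rule has_derivative_unique)
  then show ?thesis by (metis vector_eq_ldot)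
qed

lemma abs_power2_norm_diff_le:
  fixes a b :: "'a::real_normed_vector"
  assumes "norm (a - b) \<le> \<delta>" and "norm a \<le> R"
  shows "\<bar>(norm a)\<^sup>2 - (norm b)\<^sup>2\<bar> \<le> \<delta> * (2 * R + \<delta>)"
proof -
  have "norm b \<le> R + \<delta>"
    using norm_triangle_ineq2[of b a] assms by (simp add: norm_minus_commute)
  have "(norm a)\<^sup>2 - (norm b)\<^sup>2 = (norm a - norm b) * (norm a + norm b)"
    by (simp add: power2_eq_square algebra_simps)
  then have "\<bar>(norm a)\<^sup>2 - (norm b)\<^sup>2\<bar> = \<bar>norm a - norm b\<bar> * (norm a + norm b)"
    by (simp add: abs_mult)
  also have "\<dots> \<le> \<delta> * (2 * R + \<delta>)"
    using norm_triangle_ineq3[of a b] assms \<open>norm b \<le> R + \<delta>\<close>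
    by (intro mult_mono) auto
  finally show ?thesis .
qed

lemma norm_vector_matrix_mult_diff_le:
  fixes A B :: "real^'n^'m"
  shows "norm (a v* A - b v* B) \<le> norm a * norm (A - B) + norm (a - b) * norm B"
proof -
  have "a v* A - b v* B = a v* (A - B) + (a - b) v* B"
    by (simp add: algebra_simps)
  then show ?thesis
    by (metis norm_triangle_le add_mono norm_vector_matrix_mult_le)
qed

lemma norm_resid_diff_le:
  fixes xt xh :: "'n::finite \<Rightarrow> 'a \<Rightarrow> 'b::real_normed_vector"
  assumes "\<And>i. norm (xt i y - xh i y) \<le> e"
  shows "norm (resid xt x y - resid xh x y) \<le> real CARD('n) * e"
proof -
  have "norm (resid xt x y - resid xh x y) \<le> (\<Sum>i\<in>UNIV. \<bar>(resid xt x y - resid xh x y) $ i\<bar>)"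
    by (rule norm_le_l1_cart)
  also have "\<dots> \<le> (\<Sum>i\<in>(UNIV :: 'n set). e)"
  proof (rule sum_mono)
    fix i
    have "\<bar>norm (xt i y - x i) - norm (xh i y - x i)\<bar> \<le> norm (xt i y - xh i y)"
      using norm_triangle_ineq3[of "xt i y - x i" "xh i y - x i"] by simp
    then show "\<bar>(resid xt x y - resid xh x y) $ i\<bar> \<le> e"
      using assms[of i] by (simp add: resid_def)
  qed
  finally show ?thesis by simp
qed

section \<open>Fully linear models at a single iterate\<close>

locale interpolation_model =
  fixes r rt :: "real^'d \<Rightarrow> real^'n" and Dr :: "real^'d \<Rightarrow> real^'d^'n"
    and \<theta> :: "real^'d" and z :: "nat \<Rightarrow> real^'d" and \<Delta> \<Delta>max \<Lambda> L K R e \<kappa> :: real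
  defines "\<kappa> \<equiv> sqrt (real CARD('d)) * real CARD('d) * \<Lambda> * (2 * e + L)"
  assumes interp: "interp_set \<theta> z"
    and nodes: "\<And>t. t \<le> CARD('d) \<Longrightarrow> norm (z t - \<theta>) \<le> \<Delta>"
    and poised: "poised \<Lambda> \<theta> \<Delta> z"
    and \<Delta>_pos: "0 < \<Delta>" and \<Delta>_le: "\<Delta> \<le> \<Delta>max"
    and deriv: "\<And>y. y \<in> cball \<theta> \<Delta> \<Longrightarrow> (r has_derivative (*v) (Dr y)) (at y)"
    and lipschitz: "\<And>y. y \<in> cball \<theta> \<Delta> \<Longrightarrow> norm (Dr y - Dr \<theta>) \<le> L * norm (y - \<theta>)"
    and L_nonneg: "0 \<le> L"
    and jacobian_bound: "norm (Dr \<theta>) \<le> K"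
    and residual_bound: "\<And>y. y \<in> cball \<theta> \<Delta> \<Longrightarrow> norm (r y) \<le> R"
    and node_error: "\<And>t. t \<le> CARD('d) \<Longrightarrow> norm (rt (z t) - r (z t)) \<le> e * \<Delta>\<^sup>2"
begin

abbreviation J :: "real^'d^'n" where "J \<equiv> interpJ rt \<theta> z"

lemma \<Lambda>_nonneg: "0 \<le> \<Lambda>"
proof -
  have "1 \<in> {1..CARD('d)}" by simp
  from poised_interp_coord_bound[OF interp poised this, of 0] show ?thesis
    using \<Delta>_pos by simp
qed

lemma e_nonneg: "0 \<le> e"
  using order_trans[OF norm_ge_zero node_error[of 0]] \<Delta>_pos by (simp add: zero_le_mult_iff)

lemma \<kappa>_nonneg: "0 \<le> \<kappa>"
  using \<Lambda>_nonneg e_nonneg L_nonneg by (simp add: \<kappa>_def)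

lemma center_error: "norm (rt \<theta> - r \<theta>) \<le> e * \<Delta>\<^sup>2"
  using node_error[of 0] interp by (simp add: interp_set_def)

lemma remainder_bound:
  assumes "norm v \<le> \<Delta>"
  shows "norm (r (\<theta> + v) - r \<theta> - Dr \<theta> *v v) \<le> L * \<Delta>\<^sup>2"
proof -
  have "L * (norm v)\<^sup>2 \<le> L * \<Delta>\<^sup>2"
    using assms L_nonneg by (intro mult_left_mono power_mono) auto
  with jacobian_lipschitz_remainder[OF deriv lipschitz assms L_nonneg] show ?thesis
    by linarith
qed

lemma node_jacobian_error:
  assumes t: "t \<in> {1..CARD('d)}"
  shows "norm ((J - Dr \<theta>) *v (z t - \<theta>)) \<le> (2 * e + L) * \<Delta>\<^sup>2"
proof -
  let ?v = "z t - \<theta>"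
  have "J *v ?v = rt (z t) - rt \<theta>"
    using interpJ_interpolates[OF interp t, of rt] by (simp add: algebra_simps)
  then have "(J - Dr \<theta>) *v ?v
      = (rt (z t) - r (z t)) - (rt \<theta> - r \<theta>) + (r (\<theta> + ?v) - r \<theta> - Dr \<theta> *v ?v)"
    by (simp add: matrix_vector_mult_diff_rdistrib)
  also have "norm \<dots> \<le> e * \<Delta>\<^sup>2 + e * \<Delta>\<^sup>2 + L * \<Delta>\<^sup>2"
    using node_error[of t] center_error remainder_bound[OF nodes[of t]] t
    by (intro norm_triangle_le[OF add_mono] norm_triangle_le_diff[OF add_mono]) auto
  finally show ?thesis by (simp add: algebra_simps)
qed

lemma interpJ_error: "norm (J - Dr \<theta>) \<le> \<kappa> * \<Delta>"
proof -
  have "norm ((J - Dr \<theta>) *v h) \<le> (real CARD('d) * \<Lambda> * (2 * e + L) * \<Delta>) * norm h" for h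
    using poised_matrix_bound[OF interp poised \<Delta>_pos node_jacobian_error] by simp
  then show ?thesis
    by (rule norm_matrix_le_of_bound[THEN order_trans]) (simp add: \<kappa>_def mult_ac)
qed

lemma jacobian_model_error:
  assumes "norm s \<le> \<Delta>"
  shows "norm (Dr (\<theta> + s) - J) \<le> (L + \<kappa>) * \<Delta>"
proof -
  have "norm (Dr (\<theta> + s) - Dr \<theta>) \<le> L * norm s"
    using lipschitz[of "\<theta> + s"] assms by (simp add: dist_norm)
  also have "\<dots> \<le> L * \<Delta>"
    using assms L_nonneg by (rule mult_left_mono)
  finally have "norm (Dr (\<theta> + s) - Dr \<theta>) \<le> L * \<Delta>" .
  then have "norm ((Dr (\<theta> + s) - Dr \<theta>) - (J - Dr \<theta>)) \<le> L * \<Delta> + \<kappa> * \<Delta>"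
    using interpJ_error by (intro norm_triangle_le_diff[OF add_mono])
  then show ?thesis by (simp add: algebra_simps)
qed

lemma residual_model_error:
  assumes "norm s \<le> \<Delta>"
  shows "norm (r (\<theta> + s) - (rt \<theta> + J *v s)) \<le> (L + e + \<kappa>) * \<Delta>\<^sup>2"
proof -
  have "norm ((J - Dr \<theta>) *v s) \<le> \<kappa> * \<Delta> * \<Delta>"
    using norm_matrix_vector_mult_le interpJ_error assms \<kappa>_nonneg
    by (meson mult_mono norm_ge_zero order_trans)
  then have "norm ((r (\<theta> + s) - r \<theta> - Dr \<theta> *v s) - (rt \<theta> - r \<theta>) - (J - Dr \<theta>) *v s)
      \<le> L * \<Delta>\<^sup>2 + e * \<Delta>\<^sup>2 + \<kappa> * \<Delta>\<^sup>2"
    using remainder_bound[OF assms] center_error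
    by (intro norm_triangle_le_diff[OF add_mono]) (auto simp: power2_eq_square)
  then show ?thesis by (simp add: algebra_simps matrix_vector_mult_diff_rdistrib)
qed

lemma objective_model_error:
  assumes "norm s \<le> \<Delta>"
  shows "\<bar>(1 / real CARD('n)) * (norm (r (\<theta> + s)))\<^sup>2 - (1 / real CARD('n)) * (norm (rt \<theta> + J *v s))\<^sup>2\<bar>
    \<le> (1 / real CARD('n)) * (L + e + \<kappa>) * (2 * R + (L + e + \<kappa>) * \<Delta>max\<^sup>2) * \<Delta>\<^sup>2"
proof -
  have c: "0 \<le> L + e + \<kappa>" using L_nonneg e_nonneg \<kappa>_nonneg by simp
  have "\<theta> + s \<in> cball \<theta> \<Delta>" using assms by (simp add: dist_norm)
  then have "\<bar>(norm (r (\<theta> + s)))\<^sup>2 - (norm (rt \<theta> + J *v s))\<^sup>2\<bar>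
      \<le> (L + e + \<kappa>) * \<Delta>\<^sup>2 * (2 * R + (L + e + \<kappa>) * \<Delta>\<^sup>2)"
    by (intro abs_power2_norm_diff_le residual_model_error[OF assms] residual_bound)
  also have "\<dots> \<le> (L + e + \<kappa>) * \<Delta>\<^sup>2 * (2 * R + (L + e + \<kappa>) * \<Delta>max\<^sup>2)"
    using c \<Delta>_pos \<Delta>_le by (intro mult_left_mono add_left_mono power_mono) auto
  finally have "(1 / real CARD('n)) * \<bar>(norm (r (\<theta> + s)))\<^sup>2 - (norm (rt \<theta> + J *v s))\<^sup>2\<bar>
      \<le> (1 / real CARD('n)) * ((L + e + \<kappa>) * \<Delta>\<^sup>2 * (2 * R + (L + e + \<kappa>) * \<Delta>max\<^sup>2))"
    by (rule mult_left_mono) simp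
  then show ?thesis
    by (simp add: diff_divide_distrib[symmetric] mult_ac)
qed

lemma gradient_model_error:
  assumes s_le: "norm s \<le> \<Delta>"
    and g1: "GDERIV (\<lambda>y. (1 / real CARD('n)) * (norm (r y))\<^sup>2) (\<theta> + s) :> g1"
    and g2: "GDERIV (\<lambda>s. (1 / real CARD('n)) * (norm (rt \<theta> + J *v s))\<^sup>2) s :> g2"
  shows "norm (g1 - g2)
    \<le> (2 / real CARD('n)) * (R * (L + \<kappa>) + (L + e + \<kappa>) * \<Delta>max * (K + \<kappa> * \<Delta>max)) * \<Delta>"
proof -
  let ?a = "r (\<theta> + s)" and ?b = "rt \<theta> + J *v s"
  have s: "\<theta> + s \<in> cball \<theta> \<Delta>" using s_le by (simp add: dist_norm)
  have "((\<lambda>s. rt \<theta> + J *v s) has_derivative (*v) J) (at s)"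
    using has_derivative_add[OF has_derivative_const
        bounded_linear_imp_has_derivative[OF matrix_vector_mul_bounded_linear]] by simp
  then have "g1 - g2 = (2 / real CARD('n)) *\<^sub>R (?a v* Dr (\<theta> + s) - ?b v* J)"
    using gderiv_scaled_power2_norm[OF deriv[OF s] g1] gderiv_scaled_power2_norm[OF _ g2]
    by (simp add: scaleR_diff_right)
  then have "norm (g1 - g2) = (2 / real CARD('n)) * norm (?a v* Dr (\<theta> + s) - ?b v* J)"
    by simp
  also have "\<dots> \<le> (2 / real CARD('n)) *
      (norm ?a * norm (Dr (\<theta> + s) - J) + norm (?a - ?b) * norm J)"
    by (intro mult_left_mono norm_vector_matrix_mult_diff_le) simp
  also have "\<dots> \<le> (2 / real CARD('n)) *
      (R * ((L + \<kappa>) * \<Delta>) + (L + e + \<kappa>) * \<Delta>\<^sup>2 * (K + \<kappa> * \<Delta>max))"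
  proof -
    have "norm J \<le> K + \<kappa> * \<Delta>max"
      using norm_triangle_ineq[of "Dr \<theta>" "J - Dr \<theta>"] jacobian_bound interpJ_error
        mult_left_mono[OF \<Delta>_le \<kappa>_nonneg] by simp
    moreover have "0 \<le> R" using residual_bound[OF s] norm_ge_zero order_trans by blast
    moreover have "0 \<le> (L + e + \<kappa>) * \<Delta>\<^sup>2" using L_nonneg e_nonneg \<kappa>_nonneg by simp
    ultimately show ?thesis
      using residual_bound[OF s] jacobian_model_error[OF s_le] residual_model_error[OF s_le]
      by (intro mult_left_mono add_mono mult_mono) auto
  qed
  also have "\<dots> \<le> (2 / real CARD('n)) *
      (R * (L + \<kappa>) + (L + e + \<kappa>) * \<Delta>max * (K + \<kappa> * \<Delta>max)) * \<Delta>"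
  proof -
    let ?Q = "K + \<kappa> * \<Delta>max"
    have "(L + e + \<kappa>) * \<Delta> * ?Q \<le> (L + e + \<kappa>) * \<Delta>max * ?Q"
      using L_nonneg e_nonneg \<kappa>_nonneg \<Delta>_le order_trans[OF norm_ge_zero jacobian_bound] \<Delta>_pos
      by (intro mult_right_mono mult_left_mono) auto
    then have "(L + e + \<kappa>) * \<Delta> * ?Q * \<Delta> \<le> (L + e + \<kappa>) * \<Delta>max * ?Q * \<Delta>"
      using \<Delta>_pos by (intro mult_right_mono[OF \<open>(L + e + \<kappa>) * \<Delta> * ?Q \<le> _\<close>]) simp
    then have "R * ((L + \<kappa>) * \<Delta>) + (L + e + \<kappa>) * \<Delta>\<^sup>2 * ?Q
        \<le> (R * (L + \<kappa>) + (L + e + \<kappa>) * \<Delta>max * ?Q) * \<Delta>"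
      by (simp add: power2_eq_square algebra_simps)
    then show ?thesis
      by (subst mult.assoc) (rule mult_left_mono, simp_all)
  qed
  finally show ?thesis .
qed

end

section \<open>Uniform constants from Assumption A\<close>

lemma cball_subset_setB:
  "obj xh x \<theta> \<le> obj xh x \<theta>0 \<Longrightarrow> cball \<theta> Dmax \<subseteq> setB xh x \<theta>0 Dmax"
  by (auto simp: setB_def dist_norm norm_minus_commute)

lemma norm_resid_le_of_obj_le:
  assumes "obj xh x \<theta> \<le> obj xh x \<theta>0"
  shows "norm (resid xh x \<theta>) \<le> norm (resid xh x \<theta>0)"
proof -
  have "(norm (resid xh x \<theta>))\<^sup>2 \<le> (norm (resid xh x \<theta>0))\<^sup>2"
    using assms by (simp add: obj_def divide_le_cancel)
  then show ?thesis by (rule power2_le_imp_le) simp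
qed

lemma assumptionA_bounds:
  fixes xh :: "'n::finite \<Rightarrow> real^'d \<Rightarrow> 'b::real_normed_vector"
  assumes A: "assumptionA xh x \<theta>0 Dmax Dr" and "0 \<le> Dmax"
  obtains L K R where "0 \<le> L" "0 \<le> K" "0 \<le> R"
    and "\<And>a b. a \<in> setB xh x \<theta>0 Dmax \<Longrightarrow> b \<in> setB xh x \<theta>0 Dmax \<Longrightarrow>
           norm (Dr a - Dr b) \<le> L * norm (a - b)"
    and "\<And>a. a \<in> setB xh x \<theta>0 Dmax \<Longrightarrow> norm (Dr a) \<le> K"
    and "\<And>a. a \<in> setB xh x \<theta>0 Dmax \<Longrightarrow> norm (resid xh x a) \<le> R"
proof -
  let ?B = "setB xh x \<theta>0 Dmax"
  have deriv: "\<And>y. y \<in> ?B \<Longrightarrow> (resid xh x has_derivative (*v) (Dr y)) (at y)"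
    using A by (simp add: assumptionA_def)
  obtain L0 where "\<forall>a\<in>?B. \<forall>b\<in>?B. norm (Dr a - Dr b) \<le> L0 * norm (a - b)"
    using A by (auto simp: assumptionA_def)
  then have lip: "norm (Dr a - Dr b) \<le> max L0 0 * norm (a - b)" if "a \<in> ?B" "b \<in> ?B" for a b
    using that by (meson max.cobounded1 mult_right_mono norm_ge_zero order_trans)
  have \<theta>0: "\<theta>0 \<in> ?B" using \<open>0 \<le> Dmax\<close> by (auto simp: setB_def)
  obtain \<rho> where \<rho>: "\<And>y. y \<in> ?B \<Longrightarrow> dist \<theta>0 y \<le> \<rho>"
    using A bounded_any_center[of ?B \<theta>0] by (auto simp: assumptionA_def)
  define K where "K = norm (Dr \<theta>0) + max L0 0 * \<rho>"
  have K: "norm (Dr a) \<le> K" if "a \<in> ?B" for a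
  proof -
    have "norm (Dr a - Dr \<theta>0) \<le> max L0 0 * \<rho>"
      using lip[OF that \<theta>0] \<rho>[OF that]
      by (metis dist_norm max.cobounded2 mult_left_mono norm_minus_commute order_trans)
    then show ?thesis unfolding K_def using norm_triangle_sub[of "Dr a" "Dr \<theta>0"] by linarith
  qed
  have "0 \<le> K" using K[OF \<theta>0] norm_ge_zero order_trans by blast
  define R where "R = norm (resid xh x \<theta>0) + K * Dmax"
  have R: "norm (resid xh x a) \<le> R" if a: "a \<in> ?B" for a
  proof -
    obtain \<theta> where \<theta>: "obj xh x \<theta> \<le> obj xh x \<theta>0" "norm (a - \<theta>) \<le> Dmax"
      using a by (auto simp: setB_def)
    note C = cball_subset_setB[OF \<theta>(1), where Dmax = Dmax]
    have "norm (resid xh x a - resid xh x \<theta>) \<le> K * norm (a - \<theta>)"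
    proof (rule differentiable_bound[OF convex_cball])
      show "\<And>y. y \<in> cball \<theta> Dmax \<Longrightarrow>
          (resid xh x has_derivative (*v) (Dr y)) (at y within cball \<theta> Dmax)"
        by (rule has_derivative_at_withinI, rule deriv) (use C in blast)
      show "\<And>y. y \<in> cball \<theta> Dmax \<Longrightarrow> onorm ((*v) (Dr y)) \<le> K"
        using C K \<open>0 \<le> K\<close>
        by (intro onorm_le order_trans[OF norm_matrix_vector_mult_le] mult_right_mono) auto
    qed (use \<theta>(2) \<open>0 \<le> Dmax\<close> in \<open>auto simp: dist_norm norm_minus_commute\<close>)
    also have "\<dots> \<le> K * Dmax"
      using \<theta>(2) \<open>0 \<le> K\<close> by (rule mult_left_mono)
    finally show ?thesis
      unfolding R_def using norm_resid_le_of_obj_le[OF \<theta>(1)]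
        norm_triangle_sub[of "resid xh x a" "resid xh x \<theta>"] by linarith
  qed
  have "0 \<le> R" using R[OF \<theta>0] norm_ge_zero order_trans by blast
  show thesis
    by (rule that[OF _ \<open>0 \<le> K\<close> \<open>0 \<le> R\<close> lip K R]) simp_all
qed

lemma assumptionA_interpolation_model:
  fixes xh xt :: "'n::finite \<Rightarrow> real^'d \<Rightarrow> 'b::real_normed_vector"
  assumes A: "assumptionA xh x \<theta>0 Dmax Dr" and "0 < Dmax"
  obtains L K R where "0 \<le> L" "0 \<le> K" "0 \<le> R"
    and "\<And>\<theta> \<Delta> z. obj xh x \<theta> \<le> obj xh x \<theta>0 \<Longrightarrow> 0 < \<Delta> \<Longrightarrow> \<Delta> \<le> Dmax \<Longrightarrow>
      interp_set \<theta> z \<Longrightarrow> \<forall>t\<le>CARD('d). norm (z t - \<theta>) \<le> \<Delta> \<Longrightarrow> poised \<Lambda> \<theta> \<Delta> z \<Longrightarrow>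
      \<forall>t\<le>CARD('d). \<forall>i. norm (xt i (z t) - xh i (z t)) \<le> c * \<Delta>\<^sup>2 \<Longrightarrow>
      interpolation_model (resid xh x) (resid xt x) Dr \<theta> z \<Delta> Dmax \<Lambda> L K R (real CARD('n) * c)"
proof -
  let ?B = "setB xh x \<theta>0 Dmax"
  obtain L K R where bounds: "0 \<le> L" "0 \<le> K" "0 \<le> R"
    and lip: "\<And>a b. a \<in> ?B \<Longrightarrow> b \<in> ?B \<Longrightarrow> norm (Dr a - Dr b) \<le> L * norm (a - b)"
    and Dr_bound: "\<And>a. a \<in> ?B \<Longrightarrow> norm (Dr a) \<le> K"
    and r_bound: "\<And>a. a \<in> ?B \<Longrightarrow> norm (resid xh x a) \<le> R"
    using assumptionA_bounds[OF A less_imp_le[OF \<open>0 < Dmax\<close>]] by blast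
  have deriv: "\<And>y. y \<in> ?B \<Longrightarrow> (resid xh x has_derivative (*v) (Dr y)) (at y)"
    using A by (simp add: assumptionA_def)
  show thesis
  proof (rule that[OF bounds])
    fix \<theta> \<Delta> and z :: "nat \<Rightarrow> real^'d"
    assume \<theta>: "obj xh x \<theta> \<le> obj xh x \<theta>0" and \<Delta>: "0 < \<Delta>" "\<Delta> \<le> Dmax"
      and z: "interp_set \<theta> z" "\<forall>t\<le>CARD('d). norm (z t - \<theta>) \<le> \<Delta>" "poised \<Lambda> \<theta> \<Delta> z"
      and err: "\<forall>t\<le>CARD('d). \<forall>i. norm (xt i (z t) - xh i (z t)) \<le> c * \<Delta>\<^sup>2"
    have C: "y \<in> ?B" if "y \<in> cball \<theta> \<Delta>" for y
      using cball_subset_setB[OF \<theta>, where Dmax = Dmax] subset_cball[OF \<Delta>(2)] that by blast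
    have \<theta>B: "\<theta> \<in> ?B" using C \<Delta>(1) by simp
    show "interpolation_model (resid xh x) (resid xt x) Dr \<theta> z \<Delta> Dmax \<Lambda> L K R (real CARD('n) * c)"
    proof
      show "norm (resid xt x (z t) - resid xh x (z t)) \<le> real CARD('n) * c * \<Delta>\<^sup>2"
        if "t \<le> CARD('d)" for t
        using norm_resid_diff_le[of xt "z t" xh "c * \<Delta>\<^sup>2" x] err that by (simp add: mult.assoc)
    qed (use z \<Delta> bounds C deriv lip[OF _ \<theta>B] Dr_bound[OF \<theta>B] r_bound in auto)
  qed
qed

theorem lemma1:
  fixes x :: "'n::finite \<Rightarrow> 'b::real_normed_vector"
    and xh xt :: "'n \<Rightarrow> real^'d \<Rightarrow> 'b"
    and \<theta>0 :: "real^'d" and Dmax \<Lambda> c :: real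
    and Dr :: "real^'d \<Rightarrow> real^'d^'n"
  assumes A: "assumptionA xh x \<theta>0 Dmax Dr"
    and Dmax_pos: "Dmax > 0" and \<Lambda>_pos: "\<Lambda> > 0" and c_pos: "c > 0"
  shows "\<exists>kef keg kef' keg'. kef > 0 \<and> keg > 0 \<and> kef' > 0 \<and> keg' > 0 \<and>
    (\<forall>\<theta> \<Delta> z. obj xh x \<theta> \<le> obj xh x \<theta>0 \<longrightarrow> 0 < \<Delta> \<longrightarrow> \<Delta> \<le> Dmax \<longrightarrow>
       interp_set \<theta> z \<longrightarrow> (\<forall>t\<le>CARD('d). norm (z t - \<theta>) \<le> \<Delta>) \<longrightarrow>
       poised \<Lambda> \<theta> \<Delta> z \<longrightarrow>
       (\<forall>t\<le>CARD('d). \<forall>i. norm (xt i (z t) - xh i (z t)) \<le> c * \<Delta>\<^sup>2) \<longrightarrow>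
       (let J = interpJ (resid xt x) \<theta> z;
            M = (\<lambda>s. resid xt x \<theta> + J *v s);
            m = (\<lambda>s. (1 / real CARD('n)) * (norm (M s))\<^sup>2)
        in \<forall>s. norm s \<le> \<Delta> \<longrightarrow>
             \<bar>obj xh x (\<theta> + s) - m s\<bar> \<le> kef * \<Delta>\<^sup>2 \<and>
             (\<forall>g1 g2. GDERIV (obj xh x) (\<theta> + s) :> g1 \<longrightarrow> GDERIV m s :> g2 \<longrightarrow>
                 norm (g1 - g2) \<le> keg * \<Delta>) \<and>
             norm (resid xh x (\<theta> + s) - M s) \<le> kef' * \<Delta>\<^sup>2 \<and>
             norm (Dr (\<theta> + s) - J) \<le> keg' * \<Delta>))"
proof -
  obtain L K R where bounds: "0 \<le> L" "0 \<le> K" "0 \<le> R"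
    and model: "\<And>\<theta> \<Delta> z. obj xh x \<theta> \<le> obj xh x \<theta>0 \<Longrightarrow> 0 < \<Delta> \<Longrightarrow> \<Delta> \<le> Dmax \<Longrightarrow>
      interp_set \<theta> z \<Longrightarrow> \<forall>t\<le>CARD('d). norm (z t - \<theta>) \<le> \<Delta> \<Longrightarrow> poised \<Lambda> \<theta> \<Delta> z \<Longrightarrow>
      \<forall>t\<le>CARD('d). \<forall>i. norm (xt i (z t) - xh i (z t)) \<le> c * \<Delta>\<^sup>2 \<Longrightarrow>
      interpolation_model (resid xh x) (resid xt x) Dr \<theta> z \<Delta> Dmax \<Lambda> L K R (real CARD('n) * c)"
    using assumptionA_interpolation_model[OF A Dmax_pos] by blast
  define \<kappa> where "\<kappa> = sqrt (real CARD('d)) * real CARD('d) * \<Lambda> * (2 * (real CARD('n) * c) + L)"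
  define kef' where "kef' = L + real CARD('n) * c + \<kappa>"
  define keg' where "keg' = L + \<kappa>"
  define kef where "kef = (1 / real CARD('n)) * kef' * (2 * R + kef' * Dmax\<^sup>2)"
  define keg where "keg = (2 / real CARD('n)) * (R * keg' + kef' * Dmax * (K + \<kappa> * Dmax))"
  have "0 < real CARD('n) * c" using c_pos by simp
  then have "0 < \<kappa>" using \<Lambda>_pos bounds by (simp add: \<kappa>_def add_pos_nonneg)
  then have pos: "0 < kef'" "0 < keg'"
    using \<open>0 < real CARD('n) * c\<close> bounds by (simp_all add: kef'_def keg'_def)
  then have "0 < kef" "0 < keg"
    unfolding kef_def keg_def using \<open>0 < \<kappa>\<close> bounds Dmax_pos
    by (intro mult_pos_pos add_nonneg_pos mult_nonneg_nonneg; simp)+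
  note defs = obj_def[abs_def] kef_def keg_def kef'_def keg'_def \<kappa>_def
  show ?thesis
    unfolding Let_def
  proof (rule exI[of _ kef], rule exI[of _ keg], rule exI[of _ kef'], rule exI[of _ keg'],
      intro conjI pos \<open>0 < kef\<close> \<open>0 < keg\<close> allI impI, goal_cases)
    case (1 \<theta> \<Delta> z s)
    show ?case
      using interpolation_model.objective_model_error[OF model[OF 1(1-7)] 1(8)] unfolding defs .
  next
    case (2 \<theta> \<Delta> z s g1 g2)
    show ?case
      using interpolation_model.gradient_model_error[OF model[OF 2(1-7)] 2(8-10)[unfolded defs]]
      unfolding defs .
  next
    case (3 \<theta> \<Delta> z s)
    show ?case
      using interpolation_model.residual_model_error[OF model[OF 3(1-7)] 3(8)] unfolding defs .
  next
    case (4 \<theta> \<Delta> z s)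
    show ?case
      using interpolation_model.jacobian_model_error[OF model[OF 4(1-7)] 4(8)] unfolding defs .
  qed
qed

end
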